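(* Let $A$ be a real $M\times N$ matrix with transpose $A^*$, let $y\in\mathbb{R}^M$, let $a_j<b_j$ be real numbers for $j=1,\dots,N$, and let $\Omega=\prod_{j=1}^N[a_j,b_j]$. Consider the problem $$\text{(P)}\qquad \text{determine } \xi^*\in\Omega \text{ that realizes } \min\{\Psi(\xi)\;:\;\xi\in\Omega,\ A\xi=y\}.$$ Let $\lambda^*\in\mathbb{R}^M$ be a maximizer over $\lambda\in\mathbb{R}^M$ of the dual entropy $$\Sigma(y,\lambda)=\langle\lambda,y\rangle-\mathcal{M}(A^*\lambda).$$ Then the solution $\xi^*$ of (P) is given by $$\xi_j^*=\frac{a_je^{a_j(A^*\lambda^* )_j}+b_je^{b_j(A^*\lambda^* )_j}}{e^{a_j(A^*\lambda^* )_j}+e^{b_j(A^*\lambda^* )_j}},\qquad j=1,\dots,N .$$ Furthermore, $$\Psi(\xi^* )=\langle\lambda^*,y\rangle-\mathcal{M}(A^*\lambda^* )=\Sigma(y,\lambda^* ).$$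
   Context: Put $D_j=b_j-a_j$. The moment generating function $\mathcal{M}:\mathbb{R}^N\to\mathbb{R}$ is $$\mathcal{M}(\tau)=\sum_{j=1}^N\ln\left(e^{a_j\tau_j}+e^{b_j\tau_j}\right).$$ The function $\Psi:\Omega\to\mathbb{R}$ is, with the convention $0\ln0=0$, $$\Psi(\xi)=\sum_{j=1}^N\left[\frac{\xi_j-a_j}{D_j}\ln\left(\frac{\xi_j-a_j}{D_j}\right)+\frac{b_j-\xi_j}{D_j}\ln\left(\frac{b_j-\xi_j}{D_j}\right)\right].$$ *)

theory Defs
  imports "HOL-Analysis.Analysis"
begin

definition entropy_mgf :: "real ^ 'n \<Rightarrow> real ^ 'n \<Rightarrow> real ^ 'n \<Rightarrow> real" where
  "entropy_mgf a b \<tau> = (\<Sum>j\<in>UNIV. ln (exp (a $ j * \<tau> $ j) + exp (b $ j * \<tau> $ j)))"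

(* The convention 0 ln 0 = 0 needs no case distinction, since 0 * c = 0 for every
   real c.  The value is meaningful for xi in cbox a b with a $ j < b $ j. *)
definition entropy_psi :: "real ^ 'n \<Rightarrow> real ^ 'n \<Rightarrow> real ^ 'n \<Rightarrow> real" where
  "entropy_psi a b \<xi> =
     (\<Sum>j\<in>UNIV.
        (\<xi> $ j - a $ j) / (b $ j - a $ j) * ln ((\<xi> $ j - a $ j) / (b $ j - a $ j))
      + (b $ j - \<xi> $ j) / (b $ j - a $ j) * ln ((b $ j - \<xi> $ j) / (b $ j - a $ j)))"

(* On real ^ 'n the box cbox a b is the product of the intervals [a $ j, b $ j]
   (mem_box_cart). *)
definition solves_P ::
  "real ^ 'n ^ 'm \<Rightarrow> real ^ 'm \<Rightarrow> real ^ 'n \<Rightarrow> real ^ 'n \<Rightarrow> real ^ 'n \<Rightarrow> bool" where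
  "solves_P A y a b \<xi> \<longleftrightarrow>
     is_arg_min (entropy_psi a b) (\<lambda>\<xi>. \<xi> \<in> cbox a b \<and> A *v \<xi> = y) \<xi>"

definition dual_entropy ::
  "real ^ 'n ^ 'm \<Rightarrow> real ^ 'n \<Rightarrow> real ^ 'n \<Rightarrow> real ^ 'm \<Rightarrow> real ^ 'm \<Rightarrow> real" where
  "dual_entropy A a b y lam = lam \<bullet> y - entropy_mgf a b (transpose A *v lam)"

end

theory Submission
  imports Defs
begin

text \<open>
  The two sides of the problem are linked by a Fenchel--Young inequality. A number \<open>x\<close> in
  \<open>[a, b]\<close> is the mean of exactly one probability distribution on the two points \<open>a\<close>, \<open>b\<close>,
  namely the one with weights \<open>(b - x) / (b - a)\<close> and \<open>(x - a) / (b - a)\<close>, and each summand of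
  \<open>\<Psi>\<close> is the negative entropy of that distribution. Comparing it with the exponentially tilted
  weights, proportional to \<open>exp (a * t)\<close> and \<open>exp (b * t)\<close>, Gibbs' inequality gives
  \<open>\<Psi> \<xi> \<ge> \<tau> \<bullet> \<xi> - \<M> \<tau>\<close> on the box, with equality exactly when every coordinate of \<open>\<xi>\<close> is the
  mean of the tilted distribution (\<open>entropy_psi_Fenchel_Young\<close>, \<open>entropy_psi_Fenchel_Young_eq_iff\<close>).

  Take \<open>\<tau> = A\<^sup>* \<lambda>\<close>. On the set \<open>A \<xi> = y\<close> the lower bound is \<open>\<lambda> \<bullet> y - \<M> (A\<^sup>* \<lambda>)\<close>, which does not
  depend on \<open>\<xi>\<close>. Hence, as soon as the tilted mean \<open>\<xi>\<^sup>*\<close> satisfies the constraint, it attains the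
  minimum, it is the only point to do so, and the minimal value is the dual entropy.
  That \<open>\<xi>\<^sup>*\<close> satisfies the constraint is the first-order condition for a maximizer of the dual:
  the gradient of \<open>\<M>\<close> at \<open>\<tau>\<close> is the tilted mean, so the gradient of the dual entropy at \<open>\<lambda>\<close> is
  \<open>y - A \<xi>\<^sup>*\<close> (\<open>tilted_mean_feasible\<close>).
\<close>

section \<open>The tilted mean on two points\<close>

definition tilted_mean :: "real \<Rightarrow> real \<Rightarrow> real \<Rightarrow> real" where
  "tilted_mean a b t = (a * exp (a * t) + b * exp (b * t)) / (exp (a * t) + exp (b * t))"

lemma exp_add_exp_pos: "0 < exp (u::real) + exp v"
  by (simp add: add_pos_pos)

lemma tilted_mean_bounds:
  assumes "a \<le> b"
  shows "a \<le> tilted_mean a b t" "tilted_mean a b t \<le> b"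
proof -
  have "a * exp (b * t) \<le> b * exp (b * t)" "a * exp (a * t) \<le> b * exp (a * t)"
    using assms by (simp_all add: mult_right_mono)
  then show "a \<le> tilted_mean a b t" "tilted_mean a b t \<le> b"
    using exp_add_exp_pos[of "a * t" "b * t"]
    by (simp_all add: tilted_mean_def pos_le_divide_eq pos_divide_le_eq algebra_simps)
qed

lemma has_real_derivative_ln_exp_add_exp:
  "((\<lambda>t. ln (exp (a * t) + exp (b * t))) has_real_derivative tilted_mean a b t) (at t)"
  unfolding tilted_mean_def using exp_add_exp_pos[of "a * t" "b * t"]
  by (auto intro!: derivative_eq_intros simp: field_simps)

section \<open>Gibbs' inequality and the Fenchel--Young inequality\<close>

text \<open>
  The termwise form of Gibbs' inequality: \<open>ln u \<le> u - 1\<close> at \<open>u = P / p\<close>, with equality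
  only for \<open>u = 1\<close>. Summed over the entries of two probability vectors, the terms \<open>p - P\<close> cancel.
\<close>

lemma Gibbs_term:
  fixes p P :: real
  assumes "0 \<le> p" "0 < P"
  shows "p - P \<le> p * ln p - p * ln P"
    and "p * ln p - p * ln P = p - P \<Longrightarrow> p = P"
proof -
  have "p - P \<le> p * ln p - p * ln P \<and> (p * ln p - p * ln P = p - P \<longrightarrow> p = P)"
  proof (cases "p = 0")
    case True
    then show ?thesis using assms by simp
  next
    case False
    then have p: "0 < p" using assms by simp
    have "ln (P / p) \<le> P / p - 1"
      using p assms by (intro ln_le_minus_one) simp
    then have le: "p * ln (P / p) \<le> p * (P / p - 1)"
      using p by simp
    have l: "p * ln (P / p) = p * ln P - p * ln p" and r: "p * (P / p - 1) = P - p"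
      using p assms by (simp_all add: ln_div algebra_simps)
    have "p = P" if "p * ln p - p * ln P = p - P"
    proof -
      have "p * ln (P / p) = p * (P / p - 1)" using that l r by linarith
      then have "ln (P / p) = P / p - 1" using p by simp
      then have "P / p = 1" using p assms by (intro ln_eq_minus_one) simp_all
      then show ?thesis using p by simp
    qed
    then show ?thesis using le l r by linarith
  qed
  then show "p - P \<le> p * ln p - p * ln P" "p * ln p - p * ln P = p - P \<Longrightarrow> p = P"
    by blast+
qed

lemma two_point_Fenchel_Young:
  fixes a b x t :: real
  assumes ab: "a < b" and x: "a \<le> x" "x \<le> b"
  defines "h \<equiv> (x - a) / (b - a) * ln ((x - a) / (b - a))
             + (b - x) / (b - a) * ln ((b - x) / (b - a))"
  shows "x * t - ln (exp (a * t) + exp (b * t)) \<le> h"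
    and "h = x * t - ln (exp (a * t) + exp (b * t)) \<longleftrightarrow> x = tilted_mean a b t"
proof -
  define S where "S = exp (a * t) + exp (b * t)"
  define p q where "p = (x - a) / (b - a)" and "q = (b - x) / (b - a)"
  define P Q where "P = exp (b * t) / S" and "Q = exp (a * t) / S"
  have S: "0 < S" unfolding S_def by (rule exp_add_exp_pos)
  have "p + q = ((x - a) + (b - x)) / (b - a)"
    unfolding p_def q_def by (rule add_divide_distrib[symmetric])
  then have pq: "p + q = 1" using ab by simp
  have "p * (b - a) = x - a" using ab by (simp add: p_def)
  moreover have q: "q = 1 - p" using pq by linarith
  ultimately have x_eq: "x = a * q + b * p" unfolding q by (simp add: algebra_simps)
  have pos: "0 \<le> p" "0 \<le> q" "0 < P" "0 < Q"
    using ab x S by (simp_all add: p_def q_def P_def Q_def)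
  have "P + Q = (exp (b * t) + exp (a * t)) / S"
    unfolding P_def Q_def by (simp add: add_divide_distrib)
  then have PQ: "P + Q = 1"
    using S by (simp add: S_def add.commute)
  have mean: "tilted_mean a b t = a * Q + b * P"
    unfolding tilted_mean_def P_def Q_def S_def by (simp add: add_divide_distrib)
  have lnP: "ln P = b * t - ln S" and lnQ: "ln Q = a * t - ln S"
    using S by (simp_all add: P_def Q_def ln_div)
  \<comment> \<open>The lower bound is minus the cross entropy of the tilted weights relative to those
    of \<open>x\<close>, so the claim compares two probability vectors on two points.\<close>
  have "p * ln P + q * ln Q = (a * q + b * p) * t - (p + q) * ln S"
    unfolding lnP lnQ by (simp add: algebra_simps)
  then have cross: "x * t - ln S = p * ln P + q * ln Q"
    using pq x_eq by simp
  have h: "h = p * ln p + q * ln q" by (simp add: h_def p_def q_def)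
  note Gp = Gibbs_term[OF pos(1,3)] and Gq = Gibbs_term[OF pos(2,4)]
  have le: "x * t - ln S \<le> h"
    using Gp(1) Gq(1) cross h pq PQ by linarith
  then show "x * t - ln (exp (a * t) + exp (b * t)) \<le> h" by (simp add: S_def)
  have "h = x * t - ln S \<longleftrightarrow> x = tilted_mean a b t"
  proof
    assume "h = x * t - ln S"
    then have "p * ln p - p * ln P = p - P"
      using Gp(1) Gq(1) cross h pq PQ by linarith
    then have "p = P" by (rule Gp(2))
    moreover from this have "q = Q" using pq PQ by linarith
    ultimately show "x = tilted_mean a b t" using x_eq mean by simp
  next
    assume "x = tilted_mean a b t"
    moreover have "Q = 1 - P" using PQ by linarith
    ultimately have "x - a = (b - a) * P"
      using mean by (simp add: algebra_simps)
    \<comment> \<open>The mean determines the weights, because \<open>a \<noteq> b\<close>.\<close>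
    then have "p = P" using ab by (simp add: p_def)
    moreover from this have "q = Q" using pq PQ by linarith
    ultimately show "h = x * t - ln S" using cross h by simp
  qed
  then show "h = x * t - ln (exp (a * t) + exp (b * t)) \<longleftrightarrow> x = tilted_mean a b t"
    by (simp add: S_def)
qed

definition tilted_mean_vec :: "real ^ 'n \<Rightarrow> real ^ 'n \<Rightarrow> real ^ 'n \<Rightarrow> real ^ 'n" where
  "tilted_mean_vec a b \<tau> = (\<chi> j. tilted_mean (a $ j) (b $ j) (\<tau> $ j))"

lemma tilted_mean_vec_in_cbox:
  assumes "\<And>j. a $ j \<le> b $ j"
  shows "tilted_mean_vec a b \<tau> \<in> cbox a b"
  using assms by (simp add: mem_box_cart tilted_mean_vec_def tilted_mean_bounds)

lemma inner_minus_entropy_mgf: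
  "\<tau> \<bullet> \<xi> - entropy_mgf a b \<tau>
     = (\<Sum>j\<in>UNIV. \<xi> $ j * \<tau> $ j - ln (exp (a $ j * \<tau> $ j) + exp (b $ j * \<tau> $ j)))"
  by (simp add: inner_vec_def entropy_mgf_def sum_subtractf mult.commute)

lemma entropy_psi_Fenchel_Young:
  assumes "\<And>j. a $ j < b $ j" and "\<xi> \<in> cbox a b"
  shows "\<tau> \<bullet> \<xi> - entropy_mgf a b \<tau> \<le> entropy_psi a b \<xi>"
  unfolding inner_minus_entropy_mgf entropy_psi_def
  using assms by (intro sum_mono two_point_Fenchel_Young(1)) (auto simp: mem_box_cart)

text \<open>
  Equality of the sums forces equality in every coordinate, since each summand obeys the
  inequality on its own.
\<close>

lemma entropy_psi_Fenchel_Young_eq_iff: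
  assumes ab: "\<And>j. a $ j < b $ j" and \<xi>: "\<xi> \<in> cbox a b"
  shows "entropy_psi a b \<xi> = \<tau> \<bullet> \<xi> - entropy_mgf a b \<tau> \<longleftrightarrow> \<xi> = tilted_mean_vec a b \<tau>"
proof -
  define l where
    "l j = \<xi> $ j * \<tau> $ j - ln (exp (a $ j * \<tau> $ j) + exp (b $ j * \<tau> $ j))" for j
  define h where
    "h j = (\<xi> $ j - a $ j) / (b $ j - a $ j) * ln ((\<xi> $ j - a $ j) / (b $ j - a $ j))
         + (b $ j - \<xi> $ j) / (b $ j - a $ j) * ln ((b $ j - \<xi> $ j) / (b $ j - a $ j))" for j
  have bnd: "a $ j \<le> \<xi> $ j" "\<xi> $ j \<le> b $ j" for j
    using \<xi> by (simp_all add: mem_box_cart)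
  have le: "l j \<le> h j" for j
    unfolding l_def h_def using ab bnd by (rule two_point_Fenchel_Young(1))
  have eq: "h j = l j \<longleftrightarrow> \<xi> $ j = tilted_mean (a $ j) (b $ j) (\<tau> $ j)" for j
    unfolding l_def h_def using ab bnd by (rule two_point_Fenchel_Young(2))
  have "sum h UNIV = sum l UNIV \<longleftrightarrow> (\<Sum>j\<in>UNIV. h j - l j) = 0"
    by (simp add: sum_subtractf)
  also have "\<dots> \<longleftrightarrow> (\<forall>j. h j - l j = 0)"
    using le by (subst sum_nonneg_eq_0_iff) auto
  also have "\<dots> \<longleftrightarrow> \<xi> = tilted_mean_vec a b \<tau>"
    by (simp add: eq vec_eq_iff tilted_mean_vec_def)
  finally show ?thesis
    unfolding inner_minus_entropy_mgf entropy_psi_def l_def h_def .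
qed

section \<open>The first-order condition for the dual\<close>

lemma has_real_derivative_entropy_mgf_line:
  "((\<lambda>s. entropy_mgf a b (\<tau> + s *\<^sub>R \<sigma>)) has_real_derivative \<sigma> \<bullet> tilted_mean_vec a b \<tau>) (at 0)"
proof -
  have "((\<lambda>s. ln (exp (a $ j * (\<tau> $ j + s * \<sigma> $ j)) + exp (b $ j * (\<tau> $ j + s * \<sigma> $ j))))
          has_real_derivative tilted_mean (a $ j) (b $ j) (\<tau> $ j) * \<sigma> $ j) (at 0)" for j
  proof (rule DERIV_chain2[where
        f = "\<lambda>t. ln (exp (a $ j * t) + exp (b $ j * t))" and g = "\<lambda>s. \<tau> $ j + s * \<sigma> $ j"])
    show "((\<lambda>t. ln (exp (a $ j * t) + exp (b $ j * t))) has_real_derivative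
            tilted_mean (a $ j) (b $ j) (\<tau> $ j)) (at (\<tau> $ j + 0 * \<sigma> $ j))"
      using has_real_derivative_ln_exp_add_exp[of "a $ j" "b $ j" "\<tau> $ j"] by simp
    show "((\<lambda>s. \<tau> $ j + s * \<sigma> $ j) has_real_derivative \<sigma> $ j) (at 0)"
      by (auto intro!: derivative_eq_intros)
  qed
  then have "((\<lambda>s. \<Sum>j\<in>UNIV. ln (exp (a $ j * (\<tau> $ j + s * \<sigma> $ j))
                              + exp (b $ j * (\<tau> $ j + s * \<sigma> $ j))))
      has_real_derivative (\<Sum>j\<in>UNIV. tilted_mean (a $ j) (b $ j) (\<tau> $ j) * \<sigma> $ j)) (at 0)"
    by (rule DERIV_sum)
  then show ?thesis
    by (simp add: entropy_mgf_def inner_vec_def tilted_mean_vec_def mult.commute[of "\<sigma> $ _"])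
qed

lemma tilted_mean_feasible:
  fixes A :: "real ^ 'n ^ 'm"
  assumes max: "is_arg_max (dual_entropy A a b y) (\<lambda>_. True) lam"
  shows "A *v tilted_mean_vec a b (transpose A *v lam) = y"
proof -
  define \<tau> where "\<tau> = transpose A *v lam"
  \<comment> \<open>Vary \<open>lam\<close> along the residual of the constraint, which is the gradient of the dual.\<close>
  define v where "v = y - A *v tilted_mean_vec a b \<tau>"
  have line: "dual_entropy A a b y (lam + s *\<^sub>R v)
      = lam \<bullet> y + s * (v \<bullet> y) - entropy_mgf a b (\<tau> + s *\<^sub>R (transpose A *v v))" for s
    by (simp add: dual_entropy_def \<tau>_def matrix_vector_right_distrib matrix_vector_mult_scaleR
        inner_add_left)
  have "((\<lambda>s. dual_entropy A a b y (lam + s *\<^sub>R v)) has_real_derivative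
      v \<bullet> y - (transpose A *v v) \<bullet> tilted_mean_vec a b \<tau>) (at 0)"
    unfolding line
    by (auto intro!: derivative_eq_intros has_real_derivative_entropy_mgf_line)
  moreover have "v \<bullet> y - (transpose A *v v) \<bullet> tilted_mean_vec a b \<tau> = v \<bullet> v"
    by (simp add: dot_lmul_matrix v_def inner_diff_right)
  ultimately have "((\<lambda>s. dual_entropy A a b y (lam + s *\<^sub>R v)) has_real_derivative v \<bullet> v) (at 0)"
    by simp
  moreover have "dual_entropy A a b y (lam + s *\<^sub>R v)
      \<le> dual_entropy A a b y (lam + 0 *\<^sub>R v)" for s
    using max by (auto simp: is_arg_max_linorder)
  ultimately have "v \<bullet> v = 0"
    by (intro DERIV_local_max[where d = 1]) auto
  then show ?thesis by (simp add: v_def \<tau>_def)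
qed

section \<open>Duality\<close>

text \<open>
  For a maximizer of the dual there is no duality gap, and the equality case of the
  Fenchel--Young inequality identifies the primal solution.
\<close>

lemma solves_P_iff_tilted_mean:
  fixes A :: "real ^ 'n ^ 'm"
  assumes ab: "\<And>j. a $ j < b $ j"
    and max: "is_arg_max (dual_entropy A a b y) (\<lambda>_. True) lam"
  shows "solves_P A y a b \<xi> \<longleftrightarrow> \<xi> = tilted_mean_vec a b (transpose A *v lam)"
    and "entropy_psi a b (tilted_mean_vec a b (transpose A *v lam)) = dual_entropy A a b y lam"
proof -
  define \<tau> where "\<tau> = transpose A *v lam"
  define z where "z = tilted_mean_vec a b \<tau>"
  have box: "z \<in> cbox a b"
    unfolding z_def using ab by (intro tilted_mean_vec_in_cbox) (simp add: less_imp_le)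
  have feas: "A *v z = y"
    unfolding z_def \<tau>_def using max by (rule tilted_mean_feasible)
  have dual: "\<tau> \<bullet> x - entropy_mgf a b \<tau> = dual_entropy A a b y lam" if "A *v x = y" for x
    using that by (simp add: \<tau>_def dual_entropy_def dot_lmul_matrix)
  have value_z: "entropy_psi a b z = dual_entropy A a b y lam"
    using entropy_psi_Fenchel_Young_eq_iff[OF ab box, of \<tau>] dual[OF feas] by (simp add: z_def)
  then show "entropy_psi a b (tilted_mean_vec a b (transpose A *v lam)) = dual_entropy A a b y lam"
    by (simp add: z_def \<tau>_def)
  have lower: "entropy_psi a b z \<le> entropy_psi a b x" if "x \<in> cbox a b" "A *v x = y" for x
    using entropy_psi_Fenchel_Young[OF ab that(1), of \<tau>] dual[OF that(2)] value_z by simp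
  have uniq: "x = z"
    if "x \<in> cbox a b" "A *v x = y" "entropy_psi a b x \<le> entropy_psi a b z" for x
  proof -
    have "entropy_psi a b x = \<tau> \<bullet> x - entropy_mgf a b \<tau>"
      using lower[OF that(1,2)] that(3) dual[OF that(2)] value_z by simp
    then show ?thesis
      using entropy_psi_Fenchel_Young_eq_iff[OF ab that(1)] by (simp add: z_def)
  qed
  have "solves_P A y a b \<xi> \<longleftrightarrow> \<xi> = z"
    unfolding solves_P_def is_arg_min_linorder using box feas lower uniq by blast
  then show "solves_P A y a b \<xi> \<longleftrightarrow> \<xi> = tilted_mean_vec a b (transpose A *v lam)"
    by (simp add: z_def \<tau>_def)
qed

theorem theorem3p1:
  fixes A :: "real ^ 'n ^ 'm" and y :: "real ^ 'm" and a b :: "real ^ 'n"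
    and lam :: "real ^ 'm"
  assumes "\<And>j. a $ j < b $ j"
    and "is_arg_max (dual_entropy A a b y) (\<lambda>_. True) lam"
  shows "(\<exists>!\<xi>. solves_P A y a b \<xi>) \<and>
    (\<forall>\<xi>. solves_P A y a b \<xi> \<longrightarrow>
      (\<forall>j. \<xi> $ j =
         (a $ j * exp (a $ j * (transpose A *v lam) $ j)
            + b $ j * exp (b $ j * (transpose A *v lam) $ j))
         / (exp (a $ j * (transpose A *v lam) $ j) + exp (b $ j * (transpose A *v lam) $ j)))
      \<and> entropy_psi a b \<xi> = lam \<bullet> y - entropy_mgf a b (transpose A *v lam)
      \<and> lam \<bullet> y - entropy_mgf a b (transpose A *v lam) = dual_entropy A a b y lam)"
  using solves_P_iff_tilted_mean[OF assms]
  by (simp add: tilted_mean_vec_def tilted_mean_def dual_entropy_def)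

end
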